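(* Let $(X,\mathcal{A},\lambda)$ be a $\sigma$-finite measure space, $T:X\to X$ a null-preserving map, and $\mathfrak{S}=(X,\mathcal{A},\lambda,T)$. Then the following two properties are equivalent: (i) every tail set is invariant; (ii) for every $A\in\mathcal{A}$, the sets $A$ and $\hat{T}A$ remain separated if and only if $A\overset{.}{=}\varnothing$. As a consequence, $\mathfrak{S}$ is exact if and only if $\mathfrak{S}$ is ergodic and, for all $A\in\mathcal{A}$, $A$ remains separated from $\hat{T}A$ if and only if $A\overset{.}{=}\varnothing$.
   Context: For $A,B\in\mathcal{A}$ write $A\overset{.}{\subseteq}B$ if $\lambda(A\setminus B)=0$ and $A\overset{.}{=}B$ if $\lambda(A\triangle B)=0$. A measurable map $T:X\to X$ is null-preserving if $\lambda(A)=0$ implies $\lambda(T^{-1}A)=0$ for $A\in\mathcal{A}$. An essential image of $A\in\mathcal{A}$ under $T$ is a set $A'\in\mathcal{A}$ such that $T^{-1}A'\overset{.}{\supseteq}A$ and such that every $B'\in\mathcal{A}$ with $T^{-1}B'\overset{.}{\supseteq}A$ satisfies $B'\overset{.}{\supseteq}A'$. In the present ($\sigma$-finite, null-preserving) setting every $A\in\mathcal{A}$ has essential images and they form exactly one equivalence class under $\overset{.}{=}$; $\hat{T}A$ denotes an arbitrary fixed essential image of $A$. A tail set is a set $A\in\mathcal{A}$ with $A\overset{.}{=}B$ for some $B\in\bigcap_{n\ge0}T^{-n}\mathcal{A}$; $\mathfrak{S}$ is exact if every tail set $A$ satisfies $\lambda(A)=0$ or $\lambda(A^c)=0$. A set $A\in\mathcal{A}$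 is invariant if $A\overset{.}{=}T^{-1}A$; $\mathfrak{S}$ is ergodic if every invariant set $A$ satisfies $\lambda(A)=0$ or $\lambda(A^c)=0$. Sets $A,B\in\mathcal{A}$ remain separated if for every $n\ge0$ there is $A_n\in\mathcal{A}$ with $A\overset{.}{\subseteq}T^{-n}A_n$ and $B\overset{.}{\subseteq}T^{-n}A_n^c$. *)

theory Defs
  imports "HOL-Analysis.Analysis"
begin

text \<open>Since \<^const>\<open>null_sets\<close> consists of measurable sets only, the two relations below
  have their intended meaning on measurable sets, which is where they are used.\<close>

definition ess_subset :: "'a measure \<Rightarrow> 'a set \<Rightarrow> 'a set \<Rightarrow> bool" where
  "ess_subset M A B \<longleftrightarrow> A - B \<in> null_sets M"

definition ess_eq :: "'a measure \<Rightarrow> 'a set \<Rightarrow> 'a set \<Rightarrow> bool" where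
  "ess_eq M A B \<longleftrightarrow> sym_diff A B \<in> null_sets M"

definition preimage :: "'a measure \<Rightarrow> ('a \<Rightarrow> 'a) \<Rightarrow> nat \<Rightarrow> 'a set \<Rightarrow> 'a set" where
  "preimage M T n A = (T ^^ n) -` A \<inter> space M"

definition null_preserving :: "'a measure \<Rightarrow> ('a \<Rightarrow> 'a) \<Rightarrow> bool" where
  "null_preserving M T \<longleftrightarrow> T \<in> measurable M M \<and>
     (\<forall>A\<in>sets M. emeasure M A = 0 \<longrightarrow> emeasure M (preimage M T 1 A) = 0)"

definition essential_image :: "'a measure \<Rightarrow> ('a \<Rightarrow> 'a) \<Rightarrow> 'a set \<Rightarrow> 'a set \<Rightarrow> bool" where
  "essential_image M T A A' \<longleftrightarrow> A' \<in> sets M \<and> ess_subset M A (preimage M T 1 A') \<and>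
     (\<forall>B'\<in>sets M. ess_subset M A (preimage M T 1 B') \<longrightarrow> ess_subset M A' B')"

definition tail_set :: "'a measure \<Rightarrow> ('a \<Rightarrow> 'a) \<Rightarrow> 'a set \<Rightarrow> bool" where
  "tail_set M T A \<longleftrightarrow> A \<in> sets M \<and>
     (\<exists>B \<in> (\<Inter>n. preimage M T n ` sets M). ess_eq M A B)"

definition exact :: "'a measure \<Rightarrow> ('a \<Rightarrow> 'a) \<Rightarrow> bool" where
  "exact M T \<longleftrightarrow>
     (\<forall>A. tail_set M T A \<longrightarrow> emeasure M A = 0 \<or> emeasure M (space M - A) = 0)"

definition invariant_set :: "'a measure \<Rightarrow> ('a \<Rightarrow> 'a) \<Rightarrow> 'a set \<Rightarrow> bool" where
  "invariant_set M T A \<longleftrightarrow> A \<in> sets M \<and> ess_eq M A (preimage M T 1 A)"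

definition ergodic :: "'a measure \<Rightarrow> ('a \<Rightarrow> 'a) \<Rightarrow> bool" where
  "ergodic M T \<longleftrightarrow>
     (\<forall>A. invariant_set M T A \<longrightarrow> emeasure M A = 0 \<or> emeasure M (space M - A) = 0)"

definition remain_separated :: "'a measure \<Rightarrow> ('a \<Rightarrow> 'a) \<Rightarrow> 'a set \<Rightarrow> 'a set \<Rightarrow> bool" where
  "remain_separated M T A B \<longleftrightarrow> A \<in> sets M \<and> B \<in> sets M \<and>
     (\<forall>n. \<exists>C\<in>sets M. ess_subset M A (preimage M T n C) \<and>
                      ess_subset M B (preimage M T n (space M - C)))"

text \<open>Essential images exist and are unique up to null sets; in particular there are functions
  selecting an essential image of every measurable set.\<close>

lemma essential_image_exists:
  assumes "sigma_finite_measure M" and "null_preserving M T" and A: "A \<in> sets M"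
  shows "\<exists>A'. essential_image M T A A'"
proof -
  interpret sigma_finite_measure M by fact
  have T[measurable]: "T \<in> measurable M M"
    using assms(2) by (simp add: null_preserving_def)
  note A[measurable]
  define N where "N = distr (density M (indicator A)) M T"
  have T': "T \<in> measurable (density M (indicator A)) M"
    by simp
  have N: "emeasure N B = emeasure M (A \<inter> preimage M T 1 B)" if [measurable]: "B \<in> sets M" for B
  proof -
    have pre: "T -` B \<inter> space M \<in> sets M" by measurable
    have "emeasure N B = emeasure (density M (indicator A)) (T -` B \<inter> space M)"
      unfolding N_def using emeasure_distr[OF T' that] by simp
    also have "\<dots> = (\<integral>\<^sup>+x. indicator A x * indicator (T -` B \<inter> space M) x \<partial>M)"
      using pre by (subst emeasure_density) auto
    also have "\<dots> = (\<integral>\<^sup>+x. indicator (A \<inter> (T -` B \<inter> space M)) x \<partial>M)"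
      by (intro nn_integral_cong) (auto simp: indicator_def)
    also have "\<dots> = emeasure M (A \<inter> (T -` B \<inter> space M))"
      using pre by (intro nn_integral_indicator) auto
    finally show ?thesis by (simp add: preimage_def)
  qed
  have pre_sets: "preimage M T 1 B \<in> sets M" if "B \<in> sets M" for B
    using measurable_sets[OF T that] by (simp add: preimage_def)
  have setsN: "sets N = sets M" by (simp add: N_def)
  have "absolutely_continuous M N"
    unfolding absolutely_continuous_def
  proof
    fix B assume B: "B \<in> null_sets M"
    then have Bs: "B \<in> sets M" by auto
    have "emeasure M (preimage M T 1 B) = 0"
      using assms(2) B Bs by (auto simp: null_preserving_def)
    then have "emeasure M (A \<inter> preimage M T 1 B) = 0"
      using emeasure_mono[of "A \<inter> preimage M T 1 B" "preimage M T 1 B" M] pre_sets[OF Bs]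
      by simp
    then show "B \<in> null_sets N" using N[OF Bs] Bs setsN by auto
  qed
  then obtain f where f[measurable]: "f \<in> borel_measurable M" and dens: "density M f = N"
    using Radon_Nikodym[of N] setsN by blast
  define A' where "A' = {x \<in> space M. f x \<noteq> 0}"
  have A'[measurable]: "A' \<in> sets M" unfolding A'_def by measurable
  have key: "ess_subset M A (preimage M T 1 B) \<longleftrightarrow> ess_subset M A' B"
    if B: "B \<in> sets M" for B
  proof -
    note B[measurable]
    have eq: "A - preimage M T 1 B = A \<inter> preimage M T 1 (space M - B)"
      using sets.sets_into_space[OF A] measurable_space[OF T] by (auto simp: preimage_def)
    have "ess_subset M A (preimage M T 1 B) \<longleftrightarrow> emeasure N (space M - B) = 0"
      using A pre_sets[OF B] pre_sets[of "space M - B"] N[of "space M - B"] eq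
      by (auto simp: ess_subset_def null_sets_def)
    also have "\<dots> \<longleftrightarrow> (\<integral>\<^sup>+x. f x * indicator (space M - B) x \<partial>M) = 0"
      unfolding dens[symmetric] by (simp add: emeasure_density)
    also have "\<dots> \<longleftrightarrow> (AE x in M. x \<notin> A' - B)"
      by (subst nn_integral_0_iff_AE, simp, intro AE_cong) (auto simp: A'_def indicator_def)
    also have "\<dots> \<longleftrightarrow> A' - B \<in> null_sets M"
      by (intro AE_iff_null_sets[symmetric]) auto
    finally show ?thesis by (simp add: ess_subset_def)
  qed
  have "ess_subset M A' A'" by (simp add: ess_subset_def)
  then have "essential_image M T A A'"
    using A' key by (auto simp: essential_image_def)
  then show ?thesis ..
qed

lemma essential_image_unique:
  assumes "essential_image M T A A'" and "essential_image M T A A''"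
  shows "ess_eq M A' A''"
  using assms by (auto simp: essential_image_def ess_eq_def ess_subset_def)

lemma essential_image_choice_exists:
  assumes "sigma_finite_measure M" and "null_preserving M T"
  shows "\<exists>That. \<forall>A\<in>sets M. essential_image M T A (That A)"
  using essential_image_exists[OF assms] by (intro bchoice) blast

end

theory Submission
  imports Defs
begin

text \<open>Two sets \<open>A\<close>, \<open>B\<close> remain separated if and only if some tail set \<open>S\<close> contains \<open>A\<close> and is
  disjoint from \<open>B\<close>, up to null sets: if \<open>C\<^sub>n\<close> separates at time \<open>n\<close>, take
  \<open>S = limsup T\<^sup>-\<^sup>n C\<^sub>n\<close>, which lies in every \<open>T\<^sup>-\<^sup>n \<A>\<close>. If \<open>S\<close> is invariant and separates \<open>A\<close> from
  its essential image, then \<open>A \<subseteq> S = T\<^sup>-\<^sup>1 S\<close> puts the essential image inside \<open>S\<close>, so it is null, and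
  hence \<open>A\<close> is null. Conversely, a tail set \<open>S\<close> separates \<open>S - T\<^sup>-\<^sup>1 S\<close> from its essential image;
  if this forces the difference to be null for \<open>S\<close> and for its complement, then \<open>S\<close> is invariant.\<close>

section \<open>Iterated preimages and almost-everywhere forms of the set relations\<close>

lemma mem_preimage: "x \<in> preimage M T n A \<longleftrightarrow> x \<in> space M \<and> (T ^^ n) x \<in> A"
  by (auto simp: preimage_def)

lemma funpow_measurable:
  assumes "T \<in> measurable M M"
  shows "(T ^^ n) \<in> measurable M M"
proof (induction n)
  case (Suc n)
  then show ?case using assms by (auto intro: measurable_comp)
qed simp

lemma preimage_in_sets:
  assumes "T \<in> measurable M M" "A \<in> sets M"
  shows "preimage M T n A \<in> sets M"
  using measurable_sets[OF funpow_measurable[OF assms(1)] assms(2)] by (simp add: preimage_def)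

lemma ess_subset_iff_AE:
  assumes "A \<in> sets M" "B \<in> sets M"
  shows "ess_subset M A B \<longleftrightarrow> (AE x in M. x \<in> A \<longrightarrow> x \<in> B)"
  using AE_iff_null_sets[of "A - B" M] assms by (simp add: ess_subset_def)

lemma ess_eq_iff_AE:
  assumes "A \<in> sets M" "B \<in> sets M"
  shows "ess_eq M A B \<longleftrightarrow> (AE x in M. x \<in> A \<longleftrightarrow> x \<in> B)"
proof -
  have "ess_eq M A B \<longleftrightarrow> (AE x in M. x \<notin> sym_diff A B)"
    using AE_iff_null_sets[of "sym_diff A B" M] assms by (simp add: ess_eq_def)
  also have "\<dots> \<longleftrightarrow> (AE x in M. x \<in> A \<longleftrightarrow> x \<in> B)"
    by (intro AE_cong) auto
  finally show ?thesis .
qed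

lemma emeasure_0_iff_AE:
  assumes "A \<in> sets M"
  shows "emeasure M A = 0 \<longleftrightarrow> (AE x in M. x \<notin> A)"
  using AE_iff_null_sets[OF assms] assms by (auto simp: null_sets_def)

text \<open>The exceptional set of \<open>P\<close> lies in a measurable null set, whose preimage is
  again null. This is the form in which null preservation is used throughout.\<close>

lemma AE_preimage:
  assumes np: "null_preserving M T" and ae: "AE x in M. P x"
  shows "AE x in M. P (T x)"
proof -
  have T: "T \<in> measurable M M" using np by (simp add: null_preserving_def)
  obtain N where N: "{x \<in> space M. \<not> P x} \<subseteq> N" "emeasure M N = 0" "N \<in> sets M"
    using ae by (rule AE_E)
  have "emeasure M (preimage M T 1 N) = 0"
    using np N by (simp add: null_preserving_def)
  then have "AE x in M. x \<notin> preimage M T 1 N"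
    using preimage_in_sets[OF T N(3)] by (simp add: emeasure_0_iff_AE)
  with AE_space show ?thesis
  proof eventually_elim
    case (elim x)
    then show ?case using N(1) measurable_space[OF T] by (auto simp: mem_preimage)
  qed
qed

section \<open>Limsups of preimages, tail sets and separation\<close>

definition tail_limsup :: "'a measure \<Rightarrow> ('a \<Rightarrow> 'a) \<Rightarrow> (nat \<Rightarrow> 'a set) \<Rightarrow> 'a set" where
  "tail_limsup M T C = (\<Inter>m. \<Union>n\<in>{m..}. preimage M T n (C n))"

lemma mem_tail_limsup:
  "x \<in> tail_limsup M T C \<longleftrightarrow> x \<in> space M \<and> (\<forall>m. \<exists>n\<ge>m. (T ^^ n) x \<in> C n)"
  by (auto simp: tail_limsup_def mem_preimage)

lemma tail_limsup_in_sets: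
  assumes "T \<in> measurable M M" "\<And>n. C n \<in> sets M"
  shows "tail_limsup M T C \<in> sets M"
  using preimage_in_sets[OF assms(1) assms(2)] unfolding tail_limsup_def
  by (intro sets.countable_INT' sets.countable_UN') auto

lemma tail_limsup_eq_preimage:
  assumes T: "T \<in> measurable M M"
  shows "tail_limsup M T C = preimage M T k (tail_limsup M T (\<lambda>n. C (n + k)))"
proof -
  have shift: "(\<forall>m. \<exists>n\<ge>m. P n) \<longleftrightarrow> (\<forall>m. \<exists>n\<ge>m. P (n + k))" for P :: "nat \<Rightarrow> bool"
  proof safe
    fix m assume "\<forall>m. \<exists>n\<ge>m. P n"
    \<comment> \<open>The bound \<open>m + k\<close> ensures that \<open>n - k\<close> is not
      truncated and is still at least \<open>m\<close>.\<close>
    then obtain n where "n \<ge> m + k" "P n" by blast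
    then show "\<exists>n\<ge>m. P (n + k)" by (intro exI[of _ "n - k"]) auto
  next
    fix m assume "\<forall>m. \<exists>n\<ge>m. P (n + k)"
    then obtain n where "n \<ge> m" "P (n + k)" by blast
    then show "\<exists>n\<ge>m. P n" by (intro exI[of _ "n + k"]) auto
  qed
  have "x \<in> tail_limsup M T C \<longleftrightarrow> x \<in> preimage M T k (tail_limsup M T (\<lambda>n. C (n + k)))" for x
    using measurable_space[OF funpow_measurable[OF T], of x k]
      shift[of "\<lambda>n. (T ^^ n) x \<in> C n"]
    by (auto simp: mem_tail_limsup mem_preimage funpow_add)
  then show ?thesis by blast
qed

lemma tail_limsup_in_tail:
  assumes "T \<in> measurable M M" "\<And>n. C n \<in> sets M"
  shows "tail_limsup M T C \<in> (\<Inter>n. preimage M T n ` sets M)"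
proof
  fix n
  show "tail_limsup M T C \<in> preimage M T n ` sets M"
    using tail_limsup_eq_preimage[OF assms(1), of C n]
      tail_limsup_in_sets[OF assms(1), of "\<lambda>m. C (m + n)", OF assms(2)]
    by (rule image_eqI)
qed

lemma tail_set_tail_limsup:
  assumes "T \<in> measurable M M" "\<And>n. C n \<in> sets M"
  shows "tail_set M T (tail_limsup M T C)"
  using tail_limsup_in_sets[OF assms] tail_limsup_in_tail[OF assms]
  by (auto simp: tail_set_def ess_eq_def intro!: bexI[of _ "tail_limsup M T C"])

text \<open>A tail set needs one \<open>B\<close> that is a preimage at all times at once. Here the
  sets \<open>C\<close> may be chosen independently for each time, each with its own null set of
  exceptions; \<open>tail_limsup\<close> glues them into such a \<open>B\<close>.\<close>

lemma tail_set_iff: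
  assumes T: "T \<in> measurable M M" and A: "A \<in> sets M"
  shows "tail_set M T A \<longleftrightarrow> (\<forall>n. \<exists>C\<in>sets M. AE x in M. x \<in> A \<longleftrightarrow> (T ^^ n) x \<in> C)"
proof
  assume "tail_set M T A"
  then obtain B where B: "\<And>n. B \<in> preimage M T n ` sets M" and AB: "ess_eq M A B"
    unfolding tail_set_def INT_iff by (elim conjE bexE) blast
  show "\<forall>n. \<exists>C\<in>sets M. AE x in M. x \<in> A \<longleftrightarrow> (T ^^ n) x \<in> C"
  proof
    fix n
    obtain C where C: "C \<in> sets M" "B = preimage M T n C" using B by blast
    have "AE x in M. x \<in> A \<longleftrightarrow> x \<in> B"
      using AB ess_eq_iff_AE A C preimage_in_sets[OF T] by metis
    with AE_space have "AE x in M. x \<in> A \<longleftrightarrow> (T ^^ n) x \<in> C"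
      by eventually_elim (simp add: C mem_preimage)
    with C show "\<exists>C\<in>sets M. AE x in M. x \<in> A \<longleftrightarrow> (T ^^ n) x \<in> C" by blast
  qed
next
  assume "\<forall>n. \<exists>C\<in>sets M. AE x in M. x \<in> A \<longleftrightarrow> (T ^^ n) x \<in> C"
  then obtain C where C: "\<And>n. C n \<in> sets M"
    and AC: "\<And>n. AE x in M. x \<in> A \<longleftrightarrow> (T ^^ n) x \<in> C n"
    by metis
  \<comment> \<open>Countably many null sets are discarded together. Off their union a point of
    \<open>A\<close> hits every \<open>C n\<close> and any other point hits none, so the limsup
    agrees with \<open>A\<close>.\<close>
  have "AE x in M. \<forall>n. x \<in> A \<longleftrightarrow> (T ^^ n) x \<in> C n"
    using AC by (simp add: AE_all_countable)
  with AE_space have "AE x in M. x \<in> A \<longleftrightarrow> x \<in> tail_limsup M T C"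
    by eventually_elim (auto simp: mem_tail_limsup)
  then have "ess_eq M A (tail_limsup M T C)"
    using A tail_limsup_in_sets[OF T C] by (simp add: ess_eq_iff_AE)
  then show "tail_set M T A"
    using A bexI[OF _ tail_limsup_in_tail[OF T C], of "ess_eq M A"] by (simp add: tail_set_def)
qed

lemma tail_set_complement:
  assumes T: "T \<in> measurable M M" and S: "tail_set M T S"
  shows "tail_set M T (space M - S)"
proof -
  have meas: "S \<in> sets M" using S by (simp add: tail_set_def)
  have "\<exists>C\<in>sets M. AE x in M. x \<in> space M - S \<longleftrightarrow> (T ^^ n) x \<in> C" for n
  proof -
    obtain C where C: "C \<in> sets M" "AE x in M. x \<in> S \<longleftrightarrow> (T ^^ n) x \<in> C"
      using S tail_set_iff[OF T meas] by blast
    \<comment> \<open>The complement of a witness \<open>C\<close> at time \<open>n\<close> is a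
      witness for the complement of \<open>S\<close>.\<close>
    from AE_space C(2) have "AE x in M. x \<in> space M - S \<longleftrightarrow> (T ^^ n) x \<in> space M - C"
    proof eventually_elim
      case (elim x)
      then show ?case using measurable_space[OF funpow_measurable[OF T]] by blast
    qed
    with C(1) show ?thesis by blast
  qed
  with meas show ?thesis by (simp add: tail_set_iff[OF T])
qed

text \<open>Off one null set, points of \<open>A\<close> hit every \<open>C n\<close> and points of
  \<open>B\<close> hit none, so the limsup separates them. Conversely, the sets \<open>C\<close>
  that represent a separating tail set at each time are the required separators.\<close>

lemma remain_separated_iff_tail_set:
  assumes T: "T \<in> measurable M M" and A: "A \<in> sets M" and B: "B \<in> sets M"
  shows "remain_separated M T A B \<longleftrightarrow>
    (\<exists>S. tail_set M T S \<and> (AE x in M. (x \<in> A \<longrightarrow> x \<in> S) \<and> (x \<in> B \<longrightarrow> x \<notin> S)))"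
proof -
  have sep: "ess_subset M A (preimage M T n C) \<and> ess_subset M B (preimage M T n (space M - C))
      \<longleftrightarrow> (AE x in M. (x \<in> A \<longrightarrow> (T ^^ n) x \<in> C) \<and> (x \<in> B \<longrightarrow> (T ^^ n) x \<notin> C))"
    if C: "C \<in> sets M" for n C
  proof -
    have "ess_subset M A (preimage M T n C) \<and> ess_subset M B (preimage M T n (space M - C))
      \<longleftrightarrow> (AE x in M. (x \<in> A \<longrightarrow> x \<in> preimage M T n C) \<and>
                      (x \<in> B \<longrightarrow> x \<in> preimage M T n (space M - C)))"
      using C A B by (simp add: ess_subset_iff_AE preimage_in_sets[OF T])
    also have "\<dots> \<longleftrightarrow> (AE x in M. (x \<in> A \<longrightarrow> (T ^^ n) x \<in> C) \<and> (x \<in> B \<longrightarrow> (T ^^ n) x \<notin> C))"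
      using measurable_space[OF funpow_measurable[OF T]]
      by (intro AE_cong) (auto simp: mem_preimage)
    finally show ?thesis .
  qed
  show ?thesis
  proof
    assume "remain_separated M T A B"
    then have "\<forall>n. \<exists>C. C \<in> sets M \<and>
        (AE x in M. (x \<in> A \<longrightarrow> (T ^^ n) x \<in> C) \<and> (x \<in> B \<longrightarrow> (T ^^ n) x \<notin> C))"
      \<comment> \<open>\<open>conj_cong\<close> makes the premise \<open>C \<in> sets M\<close> of
        \<open>sep\<close> available while the remaining conjuncts are rewritten.\<close>
      unfolding remain_separated_def Bex_def by (simp only: sep simp_thms cong: conj_cong)
    from choice[OF this] obtain C where C: "\<And>n. C n \<in> sets M" and
      "\<And>n. AE x in M. (x \<in> A \<longrightarrow> (T ^^ n) x \<in> C n) \<and> (x \<in> B \<longrightarrow> (T ^^ n) x \<notin> C n)"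
      by blast
    then have "AE x in M. \<forall>n. (x \<in> A \<longrightarrow> (T ^^ n) x \<in> C n) \<and> (x \<in> B \<longrightarrow> (T ^^ n) x \<notin> C n)"
      by (simp only: AE_all_countable) blast
    with AE_space have "AE x in M. (x \<in> A \<longrightarrow> x \<in> tail_limsup M T C) \<and>
                                   (x \<in> B \<longrightarrow> x \<notin> tail_limsup M T C)"
      by eventually_elim (auto simp: mem_tail_limsup)
    then show "\<exists>S. tail_set M T S \<and> (AE x in M. (x \<in> A \<longrightarrow> x \<in> S) \<and> (x \<in> B \<longrightarrow> x \<notin> S))"
      using tail_set_tail_limsup[OF T C] by (intro exI[of _ "tail_limsup M T C"] conjI)
  next
    assume "\<exists>S. tail_set M T S \<and> (AE x in M. (x \<in> A \<longrightarrow> x \<in> S) \<and> (x \<in> B \<longrightarrow> x \<notin> S))"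
    then obtain S where S: "tail_set M T S"
      and AB: "AE x in M. (x \<in> A \<longrightarrow> x \<in> S) \<and> (x \<in> B \<longrightarrow> x \<notin> S)"
      by blast
    have "S \<in> sets M" using S by (simp add: tail_set_def)
    have "\<exists>C\<in>sets M. ess_subset M A (preimage M T n C) \<and>
            ess_subset M B (preimage M T n (space M - C))" for n
    proof -
      obtain C where C: "C \<in> sets M" "AE x in M. x \<in> S \<longleftrightarrow> (T ^^ n) x \<in> C"
        using S tail_set_iff[OF T \<open>S \<in> sets M\<close>] by blast
      from AB C(2) have
        "AE x in M. (x \<in> A \<longrightarrow> (T ^^ n) x \<in> C) \<and> (x \<in> B \<longrightarrow> (T ^^ n) x \<notin> C)"
        by eventually_elim blast
      with C(1) sep show ?thesis by blast
    qed
    then show "remain_separated M T A B"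
      using A B by (simp add: remain_separated_def)
  qed
qed

section \<open>Invariant sets and essential images\<close>

lemma invariant_set_iff_AE:
  assumes "T \<in> measurable M M"
  shows "invariant_set M T A \<longleftrightarrow> A \<in> sets M \<and> (AE x in M. x \<in> A \<longleftrightarrow> T x \<in> A)"
proof -
  have "(AE x in M. x \<in> A \<longleftrightarrow> x \<in> preimage M T 1 A) \<longleftrightarrow> (AE x in M. x \<in> A \<longleftrightarrow> T x \<in> A)"
    by (intro AE_cong) (simp add: mem_preimage)
  then show ?thesis
    using ess_eq_iff_AE[OF _ preimage_in_sets[OF assms]] by (auto simp: invariant_set_def)
qed

text \<open>The set \<open>A\<close> itself serves as the witness at every time.\<close>

lemma invariant_set_imp_tail_set:
  assumes np: "null_preserving M T" and inv: "invariant_set M T A"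
  shows "tail_set M T A"
proof -
  have T: "T \<in> measurable M M" using np by (simp add: null_preserving_def)
  have A: "A \<in> sets M" and ae: "AE x in M. x \<in> A \<longleftrightarrow> T x \<in> A"
    using inv invariant_set_iff_AE[OF T] by auto
  have "AE x in M. x \<in> A \<longleftrightarrow> (T ^^ n) x \<in> A" for n
  proof (induction n)
    case (Suc n)
    \<comment> \<open>The induction hypothesis is used at \<open>T x\<close>, which
      \<open>AE_preimage\<close> permits.\<close>
    from ae AE_preimage[OF np Suc.IH] show ?case
      by eventually_elim (simp add: funpow_swap1)
  qed simp
  with A show ?thesis unfolding tail_set_iff[OF T A] by blast
qed

lemma essential_image_iff_AE:
  assumes T: "T \<in> measurable M M" and A: "A \<in> sets M"
  shows "essential_image M T A A' \<longleftrightarrow> A' \<in> sets M \<and> (AE x in M. x \<in> A \<longrightarrow> T x \<in> A') \<and>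
    (\<forall>B\<in>sets M. (AE x in M. x \<in> A \<longrightarrow> T x \<in> B) \<longrightarrow> (AE x in M. x \<in> A' \<longrightarrow> x \<in> B))"
proof -
  have pre: "ess_subset M A (preimage M T 1 B) \<longleftrightarrow> (AE x in M. x \<in> A \<longrightarrow> T x \<in> B)"
    if "B \<in> sets M" for B
  proof -
    have "(AE x in M. x \<in> A \<longrightarrow> x \<in> preimage M T 1 B) \<longleftrightarrow> (AE x in M. x \<in> A \<longrightarrow> T x \<in> B)"
      by (intro AE_cong) (simp add: mem_preimage)
    then show ?thesis
      using ess_subset_iff_AE[OF A preimage_in_sets[OF T that]] by simp
  qed
  show ?thesis
    by (simp only: essential_image_def pre ess_subset_iff_AE simp_thms cong: conj_cong ball_cong)
qed

section \<open>Separation of a set from its essential image\<close>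

lemma ess_eq_empty_iff_AE:
  assumes "A \<in> sets M"
  shows "ess_eq M A {} \<longleftrightarrow> (AE x in M. x \<notin> A)"
  using assms by (simp add: ess_eq_iff_AE)

text \<open>For null \<open>A\<close> the empty set is a competitor in the minimality of
  \<open>A'\<close>, so \<open>A'\<close> is null too, and the tail set \<open>{}\<close> separates
  the two.\<close>

lemma remain_separated_essential_image_of_null:
  assumes T: "T \<in> measurable M M" and A: "A \<in> sets M"
    and A': "essential_image M T A A'" and null: "AE x in M. x \<notin> A"
  shows "remain_separated M T A A'"
proof -
  have "AE x in M. x \<in> A \<longrightarrow> T x \<in> {}"
    using null by simp
  then have "AE x in M. x \<in> A' \<longrightarrow> x \<in> {}"
    using A' unfolding essential_image_iff_AE[OF T A] by blast
  with null have "AE x in M. (x \<in> A \<longrightarrow> x \<in> {}) \<and> (x \<in> A' \<longrightarrow> x \<notin> {})"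
    by simp
  moreover have "tail_set M T {}"
    by (subst tail_set_iff[OF T]) (auto intro!: bexI[of _ "{}"])
  ultimately show ?thesis
    using A A' remain_separated_iff_tail_set[OF T A] by (auto simp: essential_image_def)
qed

lemma null_of_invariant_separation:
  assumes np: "null_preserving M T" and A: "A \<in> sets M"
    and A': "essential_image M T A A'" and S: "invariant_set M T S"
    and sep: "AE x in M. (x \<in> A \<longrightarrow> x \<in> S) \<and> (x \<in> A' \<longrightarrow> x \<notin> S)"
  shows "AE x in M. x \<notin> A"
proof -
  have T: "T \<in> measurable M M" using np by (simp add: null_preserving_def)
  have Sm: "S \<in> sets M" and inv: "AE x in M. x \<in> S \<longleftrightarrow> T x \<in> S"
    using S invariant_set_iff_AE[OF T] by auto
  from sep inv have "AE x in M. x \<in> A \<longrightarrow> T x \<in> S"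
    by eventually_elim blast
  then have "AE x in M. x \<in> A' \<longrightarrow> x \<in> S"
    using A' Sm unfolding essential_image_iff_AE[OF T A] by blast
  with sep have "AE x in M. x \<notin> A'"
    by eventually_elim blast
  \<comment> \<open>Nullity passes from \<open>A'\<close> to its preimage, which contains
    \<open>A\<close> up to a null set.\<close>
  then have null: "AE x in M. T x \<notin> A'"
    by (rule AE_preimage[OF np])
  have "AE x in M. x \<in> A \<longrightarrow> T x \<in> A'"
    using A' unfolding essential_image_iff_AE[OF T A] by blast
  with null show ?thesis
    by eventually_elim blast
qed

text \<open>The points of \<open>S - preimage M T 1 S\<close> are sent outside \<open>S\<close>, so
  minimality puts \<open>A'\<close> in the complement of \<open>S\<close>; the tail set
  \<open>S\<close> is then itself the separator.\<close>

lemma remain_separated_tail_set_escape: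
  assumes T: "T \<in> measurable M M" and S: "tail_set M T S"
    and A': "essential_image M T (S - preimage M T 1 S) A'"
  shows "remain_separated M T (S - preimage M T 1 S) A'"
proof -
  have Sm: "S \<in> sets M" using S by (simp add: tail_set_def)
  define A where "A = S - preimage M T 1 S"
  have A: "A \<in> sets M" using Sm preimage_in_sets[OF T Sm] by (auto simp: A_def)
  have "AE x in M. x \<in> A \<longrightarrow> T x \<in> space M - S"
    using AE_space
  proof eventually_elim
    case (elim x)
    then show ?case using measurable_space[OF T] by (auto simp: A_def mem_preimage)
  qed
  then have "AE x in M. x \<in> A' \<longrightarrow> x \<in> space M - S"
    using A' Sm unfolding A_def[symmetric] essential_image_iff_AE[OF T A] by blast
  then have "AE x in M. (x \<in> A \<longrightarrow> x \<in> S) \<and> (x \<in> A' \<longrightarrow> x \<notin> S)"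
    by eventually_elim (auto simp: A_def)
  then show ?thesis
    using S A A' remain_separated_iff_tail_set[OF T A]
    unfolding A_def[symmetric] by (auto simp: essential_image_def)
qed

lemma tail_sets_invariant_iff:
  assumes np: "null_preserving M T"
    and That: "\<And>A. A \<in> sets M \<Longrightarrow> essential_image M T A (That A)"
  shows "(\<forall>A. tail_set M T A \<longrightarrow> invariant_set M T A) \<longleftrightarrow>
         (\<forall>A\<in>sets M. remain_separated M T A (That A) \<longleftrightarrow> ess_eq M A {})"
proof -
  have T: "T \<in> measurable M M" using np by (simp add: null_preserving_def)
  show ?thesis
  proof
    assume inv: "\<forall>A. tail_set M T A \<longrightarrow> invariant_set M T A"
    show "\<forall>A\<in>sets M. remain_separated M T A (That A) \<longleftrightarrow> ess_eq M A {}"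
    proof
      fix A assume A: "A \<in> sets M"
      have "That A \<in> sets M" using That[OF A] by (simp add: essential_image_def)
      then show "remain_separated M T A (That A) \<longleftrightarrow> ess_eq M A {}"
        using remain_separated_iff_tail_set[OF T A] inv
          null_of_invariant_separation[OF np A That[OF A]]
          remain_separated_essential_image_of_null[OF T A That[OF A]]
          ess_eq_empty_iff_AE[OF A]
        by blast
    qed
  next
    assume sep: "\<forall>A\<in>sets M. remain_separated M T A (That A) \<longleftrightarrow> ess_eq M A {}"
    have escape: "AE x in M. x \<in> S \<longrightarrow> T x \<in> S" if S: "tail_set M T S" for S
    proof -
      let ?A = "S - preimage M T 1 S"
      have "S \<in> sets M" using S by (simp add: tail_set_def)
      then have A: "?A \<in> sets M" using preimage_in_sets[OF T] by blast
      have "AE x in M. x \<notin> ?A"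
        using sep remain_separated_tail_set_escape[OF T S That[OF A]] A ess_eq_empty_iff_AE[OF A]
        by blast
      with AE_space show ?thesis
        by eventually_elim (simp add: mem_preimage)
    qed
    show "\<forall>A. tail_set M T A \<longrightarrow> invariant_set M T A"
    proof (intro allI impI)
      fix S assume S: "tail_set M T S"
      \<comment> \<open>Applied to the complement, \<open>escape\<close> gives by contraposition
        that \<open>T x \<in> S\<close> implies \<open>x \<in> S\<close>.\<close>
      from AE_space escape[OF S] escape[OF tail_set_complement[OF T S]]
      have "AE x in M. x \<in> S \<longleftrightarrow> T x \<in> S"
        by eventually_elim blast
      with S show "invariant_set M T S"
        by (simp add: invariant_set_iff_AE[OF T] tail_set_def)
    qed
  qed
qed

section \<open>Exactness and ergodicity\<close>

lemma trivial_imp_invariant_set: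
  assumes np: "null_preserving M T" and A: "A \<in> sets M"
    and triv: "emeasure M A = 0 \<or> emeasure M (space M - A) = 0"
  shows "invariant_set M T A"
proof -
  have T: "T \<in> measurable M M" using np by (simp add: null_preserving_def)
  have "AE x in M. x \<in> A \<longleftrightarrow> T x \<in> A"
    using triv
  proof
    assume "emeasure M A = 0"
    then have "AE x in M. x \<notin> A" using A by (simp add: emeasure_0_iff_AE)
    with AE_preimage[OF np this] show ?thesis
      by eventually_elim blast
  next
    assume "emeasure M (space M - A) = 0"
    then have "AE x in M. x \<notin> space M - A" using A by (simp add: emeasure_0_iff_AE)
    with AE_space have "AE x in M. x \<in> A"
      by eventually_elim blast
    with AE_preimage[OF np this] show ?thesis
      by eventually_elim blast
  qed
  with A show ?thesis by (simp add: invariant_set_iff_AE[OF T])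
qed

text \<open>Exactness passes to invariant sets because they are tail sets, and it makes tail sets
  invariant because null and conull sets are. Conversely, ergodicity applies to a tail set once that
  set is invariant.\<close>

lemma exact_iff_ergodic_and_tail_sets_invariant:
  assumes "null_preserving M T"
  shows "exact M T \<longleftrightarrow> ergodic M T \<and> (\<forall>A. tail_set M T A \<longrightarrow> invariant_set M T A)"
proof -
  have "A \<in> sets M" if "tail_set M T A" for A
    using that by (simp add: tail_set_def)
  then show ?thesis
    using trivial_imp_invariant_set[OF assms] invariant_set_imp_tail_set[OF assms]
    unfolding exact_def ergodic_def by blast
qed

theorem theorem5p5:
  fixes M :: "'a measure" and T :: "'a \<Rightarrow> 'a" and That :: "'a set \<Rightarrow> 'a set"
  assumes "sigma_finite_measure M"
    and "null_preserving M T"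
    and "\<And>A. A \<in> sets M \<Longrightarrow> essential_image M T A (That A)"
  shows "((\<forall>A. tail_set M T A \<longrightarrow> invariant_set M T A) \<longleftrightarrow>
          (\<forall>A\<in>sets M. remain_separated M T A (That A) \<longleftrightarrow> ess_eq M A {})) \<and>
         (exact M T \<longleftrightarrow>
            ergodic M T \<and>
            (\<forall>A\<in>sets M. remain_separated M T A (That A) \<longleftrightarrow> ess_eq M A {}))"
  using tail_sets_invariant_iff[OF assms(2,3)]
    exact_iff_ergodic_and_tail_sets_invariant[OF assms(2)]
  by simp

end
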